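(* Let $\Lambda=\mathcal K\mathcal Q/\langle\rho\rangle$ be a domestic string algebra. Then there are only finitely many hereditary H-strings for $\Lambda$.
   Context: STRINGS. $\mathcal K$ is an algebraically closed field. A string algebra is $\Lambda=\mathcal K\mathcal Q/\langle\rho\rangle$ with $\mathcal Q=(Q_0,Q_1,s,t)$ a finite quiver and $\rho$ a set of paths of length $\ge2$, none a subpath of another, such that: every vertex is the source of at most two and the target of at most two arrows; for every arrow $b$ there is at most one arrow $a$ with $s(a)=t(b)$, $ab\notin\rho$, and at most one arrow $c$ with $t(c)=s(b)$, $bc\notin\rho$; all sufficiently long paths have a subpath in $\rho$. Words are composed from right to left. Fix $\sigma,\varepsilon:Q_1\to\{1,-1\}$ with $\sigma(a)=-\sigma(b)$ for distinct arrows with the same source, $\varepsilon(a)=-\varepsilon(b)$ for distinct arrows with the same target, and $\sigma(a)=-\varepsilon(b)$ whenever $s(a)=t(b)$ and $ab\notin\rho$. Syllables are arrows (direct) and their formal inverses (inverse), with $s(a^{-1})=t(a)$, $t(a^{-1})=s(a)$, $\sigma(a^{-1})=\varepsilon(a)$, $\varepsilon(a^{-1})=\sigma(a)$. A string of length $n>0$ is a word $\alpha_n\cdots\alpha_1$ of syllables with $s(\alpha_{i+1})=t(\alpha_i)$, $\alpha_{i+1}\ne\alpha_i^{-1}$, and no subword in $\rho\cup\rho^{-1}$; its first syllable is $\alpha_1$ (determining $s,\sigma$) and its last is $\alpha_n$ (determining $t,\varepsilon$). For each vertex $v$ and $i\in\{1,-1\}$ there is a length-$0$ string $1_{(v,i)}$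 with $s=t=v$, $\sigma=-i$, $\varepsilon=i$; $x1_{(v,i)}=x$ is defined iff $s(x)=v,\sigma(x)=-i$, and $1_{(v,i)}x=x$ is defined iff $t(x)=v,\varepsilon(x)=i$. If $z=yx$ is a string then $x$ is called a left substring and $y$ a right substring of $z$. A band is a string $b$ with $s(b)=t(b)$ whose first syllable is inverse and last syllable is direct, such that $b^n$ is a string for all $n\ge1$ and $b$ is not a proper power of a string. $\Lambda$ is domestic if it has only finitely many bands. H-STRINGS. Strings $y_1,y_2$ are H-equivalent, $y_1\equiv_H y_2$, if $t(y_1)=t(y_2)$ and for each string $x$ with $s(x)=t(y_1)$, $xy_1$ is a string iff $xy_2$ is a string. A string $y$ is an H-string if $y\not\equiv_H y'$ for each proper left substring $y'$ of $y$. A string is a hereditary H-string if each of its left substrings is an H-string. *)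

theory Defs
  imports
    "HOL-Algebra.Algebraic_Closure"
    "HOL-Algebra.QuotRing"
    "HOL-Algebra.Module"
    "HOL-Library.Sublist"
    "Graph_Theory.Digraph"
begin

section \<open>Paths and the algebra of a quiver with relations\<close>

text \<open>
  A quiver is a \<^typ>\<open>('v, 'a) pre_digraph\<close>; loops and parallel arrows are allowed, \<^const>\<open>tail\<close>
  is the source map and \<^const>\<open>head\<close> the target map.  All words are written, and composed, from
  right to left: the list \<open>[a\<^sub>n, \<dots>, a\<^sub>1]\<close> stands for \<open>a\<^sub>n \<dots> a\<^sub>1\<close>, whose first letter is
  the \<^const>\<open>last\<close> list element, and \<open>yx\<close> is \<open>y @ x\<close>.
  A path is a pair of its starting vertex and its list of arrows, \<open>(v, [])\<close> being the trivial path
  at \<open>v\<close>.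
\<close>

definition paths :: "('v, 'a) pre_digraph \<Rightarrow> ('v \<times> 'a list) set" where
  "paths Q = {(v, p). v \<in> verts Q \<and> set p \<subseteq> arcs Q \<and>
     successively (\<lambda>a b. tail Q a = head Q b) p \<and> (p \<noteq> [] \<longrightarrow> tail Q (last p) = v)}"

definition path_end :: "('v, 'a) pre_digraph \<Rightarrow> 'v \<times> 'a list \<Rightarrow> 'v" where
  "path_end Q x = (if snd x = [] then fst x else head Q (hd (snd x)))"

text \<open>
  The path algebra: finitely supported functions from paths to \<open>K\<close>.  In the product the coefficient
  of a path is the sum over all ways of cutting it into two paths.
\<close>

definition path_algebra ::
    "'k ring \<Rightarrow> ('v, 'a) pre_digraph \<Rightarrow> ('k, 'v \<times> 'a list \<Rightarrow> 'k) module" where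
  "path_algebra K Q =
    \<lparr> carrier = {f. (\<forall>x. f x \<in> carrier K) \<and> finite {x. f x \<noteq> \<zero>\<^bsub>K\<^esub>} \<and>
                     {x. f x \<noteq> \<zero>\<^bsub>K\<^esub>} \<subseteq> paths Q},
      monoid.mult = (\<lambda>f g (v, p). \<Oplus>\<^bsub>K\<^esub>n\<in>{..length p}.
                f (path_end Q (v, drop n p), take n p) \<otimes>\<^bsub>K\<^esub> g (v, drop n p)),
      one = (\<lambda>(v, p). if p = [] \<and> v \<in> verts Q then \<one>\<^bsub>K\<^esub> else \<zero>\<^bsub>K\<^esub>),
      zero = (\<lambda>x. \<zero>\<^bsub>K\<^esub>),
      add = (\<lambda>f g x. f x \<oplus>\<^bsub>K\<^esub> g x),
      module.smult = (\<lambda>c f x. c \<otimes>\<^bsub>K\<^esub> f x) \<rparr>"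

text \<open>Relations are paths of positive length, so their arrow lists determine them.\<close>

definition relation_element ::
    "'k ring \<Rightarrow> ('v, 'a) pre_digraph \<Rightarrow> 'a list \<Rightarrow> ('v \<times> 'a list \<Rightarrow> 'k)" where
  "relation_element K Q r =
     (\<lambda>x. if x = (tail Q (last r), r) then \<one>\<^bsub>K\<^esub> else \<zero>\<^bsub>K\<^esub>)"

definition relation_ideal ::
    "'k ring \<Rightarrow> ('v, 'a) pre_digraph \<Rightarrow> 'a list set \<Rightarrow> ('v \<times> 'a list \<Rightarrow> 'k) set" where
  "relation_ideal K Q \<rho> = Idl\<^bsub>path_algebra K Q\<^esub> (relation_element K Q ` \<rho>)"

text \<open>
  The algebra \<open>KQ/\<langle>\<rho>\<rangle>\<close>: the ring \<open>path_algebra K Q Quot relation_ideal K Q \<rho>\<close>, together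
  with the induced scalar multiplication.
\<close>

definition bound_quiver_algebra ::
    "'k ring \<Rightarrow> ('v, 'a) pre_digraph \<Rightarrow> 'a list set
      \<Rightarrow> ('k, ('v \<times> 'a list \<Rightarrow> 'k) set) module" where
  "bound_quiver_algebra K Q \<rho> =
    (let A = path_algebra K Q; I = relation_ideal K Q \<rho> in
     \<lparr> carrier = carrier (A Quot I), monoid.mult = monoid.mult (A Quot I), one = one (A Quot I),
       zero = zero (A Quot I), add = add (A Quot I),
       module.smult = (\<lambda>c S. \<Union>f\<in>S. I +>\<^bsub>A\<^esub> (c \<odot>\<^bsub>A\<^esub> f)) \<rparr>)"


section \<open>String algebras\<close>

locale string_algebra = fin_digraph Q
  for K :: "'k ring" and Q :: "('v, 'a) pre_digraph" and \<rho> :: "'a list set"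
    and \<Lambda> :: "('k, ('v \<times> 'a list \<Rightarrow> 'k) set) module" +
  assumes algebraically_closed_field: "algebraically_closed K"
    and algebra_eq: "\<Lambda> = bound_quiver_algebra K Q \<rho>"
    and relations_paths: "r \<in> \<rho> \<Longrightarrow> r \<in> snd ` paths Q"
    and relations_length: "r \<in> \<rho> \<Longrightarrow> 2 \<le> length r"
    and relations_minimal: "r \<in> \<rho> \<Longrightarrow> r' \<in> \<rho> \<Longrightarrow> sublist r r' \<Longrightarrow> r = r'"
    and out_degree: "v \<in> verts Q \<Longrightarrow> card {a \<in> arcs Q. tail Q a = v} \<le> 2"
    and in_degree: "v \<in> verts Q \<Longrightarrow> card {a \<in> arcs Q. head Q a = v} \<le> 2"
    and unique_continuation:
      "b \<in> arcs Q \<Longrightarrow> \<exists>\<^sub>\<le>\<^sub>1a. a \<in> arcs Q \<and> tail Q a = head Q b \<and> [a, b] \<notin> \<rho>"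
    and unique_precontinuation:
      "b \<in> arcs Q \<Longrightarrow> \<exists>\<^sub>\<le>\<^sub>1c. c \<in> arcs Q \<and> head Q c = tail Q b \<and> [b, c] \<notin> \<rho>"
    and long_paths:
      "\<exists>N. \<forall>p \<in> snd ` paths Q. N \<le> length p \<longrightarrow> (\<exists>r\<in>\<rho>. sublist r p)"

definition sign_functions ::
    "('v, 'a) pre_digraph \<Rightarrow> 'a list set \<Rightarrow> ('a \<Rightarrow> int) \<Rightarrow> ('a \<Rightarrow> int) \<Rightarrow> bool" where
  "sign_functions Q \<rho> \<sigma> \<epsilon> \<longleftrightarrow>
     (\<forall>a\<in>arcs Q. \<sigma> a \<in> {1, -1} \<and> \<epsilon> a \<in> {1, -1}) \<and>
     (\<forall>a\<in>arcs Q. \<forall>b\<in>arcs Q. a \<noteq> b \<and> tail Q a = tail Q b \<longrightarrow> \<sigma> a = - \<sigma> b) \<and>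
     (\<forall>a\<in>arcs Q. \<forall>b\<in>arcs Q. a \<noteq> b \<and> head Q a = head Q b \<longrightarrow> \<epsilon> a = - \<epsilon> b) \<and>
     (\<forall>a\<in>arcs Q. \<forall>b\<in>arcs Q. tail Q a = head Q b \<and> [a, b] \<notin> \<rho> \<longrightarrow> \<sigma> a = - \<epsilon> b)"


section \<open>Strings and bands\<close>

datatype 'a syllable = is_direct: Direct (arrow: 'a) | Inverse (arrow: 'a)

fun syl_inverse :: "'a syllable \<Rightarrow> 'a syllable" where
  "syl_inverse (Direct a) = Inverse a"
| "syl_inverse (Inverse a) = Direct a"

fun syl_source :: "('v, 'a) pre_digraph \<Rightarrow> 'a syllable \<Rightarrow> 'v" where
  "syl_source Q (Direct a) = tail Q a"
| "syl_source Q (Inverse a) = head Q a"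

fun syl_target :: "('v, 'a) pre_digraph \<Rightarrow> 'a syllable \<Rightarrow> 'v" where
  "syl_target Q (Direct a) = head Q a"
| "syl_target Q (Inverse a) = tail Q a"

fun syl_sigma :: "('a \<Rightarrow> int) \<Rightarrow> ('a \<Rightarrow> int) \<Rightarrow> 'a syllable \<Rightarrow> int" where
  "syl_sigma \<sigma> \<epsilon> (Direct a) = \<sigma> a"
| "syl_sigma \<sigma> \<epsilon> (Inverse a) = \<epsilon> a"

fun syl_epsilon :: "('a \<Rightarrow> int) \<Rightarrow> ('a \<Rightarrow> int) \<Rightarrow> 'a syllable \<Rightarrow> int" where
  "syl_epsilon \<sigma> \<epsilon> (Direct a) = \<epsilon> a"
| "syl_epsilon \<sigma> \<epsilon> (Inverse a) = \<sigma> a"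

text \<open>
  \<open>Trivial v i\<close> is the length-0 string \<open>1\<^sub>(\<^sub>v\<^sub>,\<^sub>i\<^sub>)\<close>; \<open>Word xs\<close> is a word of positive length,
  again written from right to left.
\<close>

datatype ('v, 'a) qword = Trivial 'v int | Word "'a syllable list"

fun is_string :: "('v, 'a) pre_digraph \<Rightarrow> 'a list set \<Rightarrow> ('v, 'a) qword \<Rightarrow> bool" where
  "is_string Q \<rho> (Trivial v i) \<longleftrightarrow> v \<in> verts Q \<and> i \<in> {1, -1}"
| "is_string Q \<rho> (Word xs) \<longleftrightarrow>
     xs \<noteq> [] \<and> arrow ` set xs \<subseteq> arcs Q \<and>
     successively (\<lambda>x y. syl_source Q x = syl_target Q y \<and> x \<noteq> syl_inverse y) xs \<and>
     (\<forall>r\<in>\<rho>. \<not> sublist (map Direct r) xs \<and> \<not> sublist (rev (map Inverse r)) xs)"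

fun source :: "('v, 'a) pre_digraph \<Rightarrow> ('v, 'a) qword \<Rightarrow> 'v" where
  "source Q (Trivial v i) = v"
| "source Q (Word xs) = syl_source Q (last xs)"

fun target :: "('v, 'a) pre_digraph \<Rightarrow> ('v, 'a) qword \<Rightarrow> 'v" where
  "target Q (Trivial v i) = v"
| "target Q (Word xs) = syl_target Q (hd xs)"

fun sigma :: "('a \<Rightarrow> int) \<Rightarrow> ('a \<Rightarrow> int) \<Rightarrow> ('v, 'a) qword \<Rightarrow> int" where
  "sigma \<sigma> \<epsilon> (Trivial v i) = - i"
| "sigma \<sigma> \<epsilon> (Word xs) = syl_sigma \<sigma> \<epsilon> (last xs)"

fun epsilon :: "('a \<Rightarrow> int) \<Rightarrow> ('a \<Rightarrow> int) \<Rightarrow> ('v, 'a) qword \<Rightarrow> int" where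
  "epsilon \<sigma> \<epsilon> (Trivial v i) = i"
| "epsilon \<sigma> \<epsilon> (Word xs) = syl_epsilon \<sigma> \<epsilon> (hd xs)"

text \<open>
  The partial composition \<open>yx\<close>, \<^const>\<open>None\<close> where undefined.  Two words of positive length are
  simply concatenated; whether the result is a string is a separate question.  The first two
  equations agree on pairs of length-0 strings.
\<close>

fun compose :: "('v, 'a) pre_digraph \<Rightarrow> ('a \<Rightarrow> int) \<Rightarrow> ('a \<Rightarrow> int)
    \<Rightarrow> ('v, 'a) qword \<Rightarrow> ('v, 'a) qword \<Rightarrow> ('v, 'a) qword option" where
  "compose Q \<sigma> \<epsilon> y (Trivial v i) =
     (if source Q y = v \<and> sigma \<sigma> \<epsilon> y = - i then Some y else None)"
| "compose Q \<sigma> \<epsilon> (Trivial v i) x =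
     (if target Q x = v \<and> epsilon \<sigma> \<epsilon> x = i then Some x else None)"
| "compose Q \<sigma> \<epsilon> (Word ys) (Word xs) = Some (Word (ys @ xs))"

definition composes_to_string :: "('v, 'a) pre_digraph \<Rightarrow> 'a list set \<Rightarrow> ('a \<Rightarrow> int)
    \<Rightarrow> ('a \<Rightarrow> int) \<Rightarrow> ('v, 'a) qword \<Rightarrow> ('v, 'a) qword \<Rightarrow> bool" where
  "composes_to_string Q \<rho> \<sigma> \<epsilon> y x \<longleftrightarrow>
     (\<exists>z. compose Q \<sigma> \<epsilon> y x = Some z \<and> is_string Q \<rho> z)"

definition left_substring :: "('v, 'a) pre_digraph \<Rightarrow> 'a list set \<Rightarrow> ('a \<Rightarrow> int)
    \<Rightarrow> ('a \<Rightarrow> int) \<Rightarrow> ('v, 'a) qword \<Rightarrow> ('v, 'a) qword \<Rightarrow> bool" where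
  "left_substring Q \<rho> \<sigma> \<epsilon> x z \<longleftrightarrow>
     is_string Q \<rho> z \<and> is_string Q \<rho> x \<and>
     (\<exists>y. is_string Q \<rho> y \<and> compose Q \<sigma> \<epsilon> y x = Some z)"

definition word_power :: "'a syllable list \<Rightarrow> nat \<Rightarrow> 'a syllable list" where
  "word_power w n = concat (replicate n w)"

definition is_band :: "('v, 'a) pre_digraph \<Rightarrow> 'a list set \<Rightarrow> ('v, 'a) qword \<Rightarrow> bool" where
  "is_band Q \<rho> b \<longleftrightarrow>
     (\<exists>xs. b = Word xs \<and> is_string Q \<rho> b \<and> source Q b = target Q b \<and>
       \<not> is_direct (last xs) \<and> is_direct (hd xs) \<and>
       (\<forall>n\<ge>1. is_string Q \<rho> (Word (word_power xs n))) \<and>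
       \<not> (\<exists>w n. n \<ge> 2 \<and> is_string Q \<rho> (Word w) \<and> xs = word_power w n))"

definition domestic :: "('v, 'a) pre_digraph \<Rightarrow> 'a list set \<Rightarrow> bool" where
  "domestic Q \<rho> \<longleftrightarrow> finite {b. is_band Q \<rho> b}"


section \<open>H-strings\<close>

definition H_equivalent :: "('v, 'a) pre_digraph \<Rightarrow> 'a list set \<Rightarrow> ('a \<Rightarrow> int)
    \<Rightarrow> ('a \<Rightarrow> int) \<Rightarrow> ('v, 'a) qword \<Rightarrow> ('v, 'a) qword \<Rightarrow> bool" where
  "H_equivalent Q \<rho> \<sigma> \<epsilon> y\<^sub>1 y\<^sub>2 \<longleftrightarrow>
     is_string Q \<rho> y\<^sub>1 \<and> is_string Q \<rho> y\<^sub>2 \<and> target Q y\<^sub>1 = target Q y\<^sub>2 \<and>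
     (\<forall>x. is_string Q \<rho> x \<and> source Q x = target Q y\<^sub>1 \<longrightarrow>
        (composes_to_string Q \<rho> \<sigma> \<epsilon> x y\<^sub>1 \<longleftrightarrow> composes_to_string Q \<rho> \<sigma> \<epsilon> x y\<^sub>2))"

definition H_string :: "('v, 'a) pre_digraph \<Rightarrow> 'a list set \<Rightarrow> ('a \<Rightarrow> int)
    \<Rightarrow> ('a \<Rightarrow> int) \<Rightarrow> ('v, 'a) qword \<Rightarrow> bool" where
  "H_string Q \<rho> \<sigma> \<epsilon> y \<longleftrightarrow>
     is_string Q \<rho> y \<and>
     (\<forall>y'. left_substring Q \<rho> \<sigma> \<epsilon> y' y \<and> y' \<noteq> y \<longrightarrow> \<not> H_equivalent Q \<rho> \<sigma> \<epsilon> y y')"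

definition hereditary_H_string :: "('v, 'a) pre_digraph \<Rightarrow> 'a list set \<Rightarrow> ('a \<Rightarrow> int)
    \<Rightarrow> ('a \<Rightarrow> int) \<Rightarrow> ('v, 'a) qword \<Rightarrow> bool" where
  "hereditary_H_string Q \<rho> \<sigma> \<epsilon> y \<longleftrightarrow>
     is_string Q \<rho> y \<and> (\<forall>y'. left_substring Q \<rho> \<sigma> \<epsilon> y' y \<longrightarrow> H_string Q \<rho> \<sigma> \<epsilon> y')"

end

theory Submission
  imports Defs
begin

text \<open>
  Relations have length at most some \<open>N\<close>, since every proper subpath of a relation avoids all
  relations and long paths do not.  So whether \<open>xy\<close> is a string depends, for strings \<open>x\<close> and \<open>y\<close>,
  only on \<open>x\<close> and the last \<open>N\<close> syllables of \<open>y\<close>: up to H-equivalence there are finitely many strings.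
  The left substrings of a hereditary H-string are pairwise H-inequivalent, so by pigeonhole its
  length is bounded.
\<close>

context string_algebra
begin

text \<open>Words run from right to left, so \<open>tl\<close> removes the arrow traversed last and
  the path keeps its starting vertex.\<close>

lemma tl_path:
  assumes "p \<in> snd ` paths Q"
  shows "tl p \<in> snd ` paths Q"
proof -
  obtain v where v: "(v, p) \<in> paths Q"
    using assms by auto
  then have "(v, tl p) \<in> paths Q"
    by (cases p) (auto simp: paths_def successively_Cons)
  then show ?thesis
    by force
qed

lemma relation_length_bounded:
  obtains N where "1 \<le> N" "\<And>r. r \<in> \<rho> \<Longrightarrow> length r \<le> N"
proof -
  obtain N where N: "\<And>p. p \<in> snd ` paths Q \<Longrightarrow> N \<le> length p \<Longrightarrow> \<exists>r\<in>\<rho>. sublist r p"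
    using long_paths by blast
  have "length r \<le> Suc N" if r: "r \<in> \<rho>" for r
  proof (rule ccontr)
    assume "\<not> length r \<le> Suc N"
    then have "N \<le> length (tl r)"
      by simp
    then obtain r' where r': "r' \<in> \<rho>" "sublist r' (tl r)"
      using N[OF tl_path[OF relations_paths[OF r]]] by blast
    then have "sublist r' r"
      by (metis sublist_order.order.trans sublist_tl)
    \<comment> \<open>Minimality would make \<open>r\<close> a sublist of its own tail, which only
      the empty list is.\<close>
    then have "r' = r"
      using relations_minimal r r'(1) by blast
    then show False
      using sublist_length_le[OF r'(2)] relations_length[OF r] by simp
  qed
  then show ?thesis
    \<comment> \<open>A successor is positive, so a window of this length always contains the head
      syllable of a nonempty word.\<close>
    by (intro that[of "Suc N"]) auto
qed

end

lemma prefix_take_iff: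
  assumes "length xs \<le> n"
  shows "prefix xs (take n ys) \<longleftrightarrow> prefix xs ys"
proof -
  have prefix_iff: "prefix xs zs \<longleftrightarrow> take (length xs) zs = xs" for zs
    by (metis append_eq_conv_conj prefixE take_is_prefix)
  show ?thesis
    using assms by (simp add: prefix_iff min_absorb1)
qed

text \<open>An occurrence of \<open>p\<close> in \<open>xs @ zs\<close> outside \<open>zs\<close>
  lies in \<open>xs\<close> or straddles the junction. A straddling one reaches at most
  \<open>n\<close> letters into \<open>zs\<close>, and \<open>ys\<close> starts with the same
  letters.\<close>

lemma sublist_append_transfer:
  assumes "take n ys = take n zs" "length p \<le> n" "sublist p (xs @ zs)" "\<not> sublist p zs"
  shows "sublist p (xs @ ys)"
  using assms(3,4) unfolding sublist_append
proof (elim disjE)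
  assume "\<exists>xs1 xs2. p = xs1 @ xs2 \<and> suffix xs1 xs \<and> prefix xs2 zs"
  then obtain p1 p2 where p: "p = p1 @ p2" "suffix p1 xs" "prefix p2 zs"
    by blast
  have "length p2 \<le> n"
    using assms(2) p(1) by simp
  then have "prefix p2 ys"
    using assms(1) p(3) by (metis prefix_take_iff)
  then show "sublist p xs \<or> sublist p ys \<or>
      (\<exists>xs1 xs2. p = xs1 @ xs2 \<and> suffix xs1 xs \<and> prefix xs2 ys)"
    using p by blast
qed auto

lemma is_string_sublist:
  assumes "is_string Q \<rho> (Word zs)" "sublist xs zs" "xs \<noteq> []"
  shows "is_string Q \<rho> (Word xs)"
proof -
  obtain ps ss where "zs = ps @ xs @ ss"
    using assms(2) by (auto simp: sublist_def)
  moreover have "\<not> sublist p xs" if "\<not> sublist p zs" for p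
    using that assms(2) sublist_order.order.trans by blast
  ultimately show ?thesis
    using assms(1,3) by (auto simp: successively_append_iff)
qed

lemma is_string_append_transfer:
  assumes N: "1 \<le> N" "\<And>r. r \<in> \<rho> \<Longrightarrow> length r \<le> N"
    and "take N ys = take N zs" "is_string Q \<rho> (Word zs)" "is_string Q \<rho> (Word (xs @ ys))"
    and "ys \<noteq> []"
  shows "is_string Q \<rho> (Word (xs @ zs))"
proof -
  \<comment> \<open>The head is the syllable meeting \<open>xs\<close>, so it decides whether the
    junction is composable and reduced.\<close>
  have "hd ys = hd zs"
    using assms(3) N(1) by (metis hd_take less_le_trans zero_less_one)
  moreover have "\<not> sublist (map Direct r) (xs @ zs)" "\<not> sublist (rev (map Inverse r)) (xs @ zs)"
    if "r \<in> \<rho>" for r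
    using sublist_append_transfer[OF assms(3), of "map Direct r" xs]
      sublist_append_transfer[OF assms(3), of "rev (map Inverse r)" xs] N(2)[OF that] assms(4,5) that
    by auto
  ultimately show ?thesis
    using assms(4-6) by (auto simp: successively_append_iff)
qed

lemma H_equivalent_if_take_eq:
  assumes N: "1 \<le> N" "\<And>r. r \<in> \<rho> \<Longrightarrow> length r \<le> N"
    and take: "take N ys = take N zs"
    and ys: "is_string Q \<rho> (Word ys)" and zs: "is_string Q \<rho> (Word zs)"
  shows "H_equivalent Q \<rho> \<sigma> \<epsilon> (Word ys) (Word zs)"
proof -
  have ne: "ys \<noteq> []" "zs \<noteq> []"
    using ys zs by auto
  have hd: "hd ys = hd zs"
    using take N(1) by (metis hd_take less_le_trans zero_less_one)
  have "composes_to_string Q \<rho> \<sigma> \<epsilon> x (Word ys) \<longleftrightarrow> composes_to_string Q \<rho> \<sigma> \<epsilon> x (Word zs)" for x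
  proof (cases x)
    \<comment> \<open>Composing with a length-0 string tests only \<open>target\<close> and
      \<open>epsilon\<close>, which depend on the head syllable.\<close>
    case (Trivial v i)
    then show ?thesis
      using hd ys zs by (auto simp: composes_to_string_def simp del: is_string.simps)
  next
    case (Word xs)
    then show ?thesis
      using is_string_append_transfer[OF N take zs _ ne(1)]
        is_string_append_transfer[OF N take[symmetric] ys _ ne(2)]
      by (auto simp: composes_to_string_def simp del: is_string.simps)
  qed
  then show ?thesis
    using ys zs hd unfolding H_equivalent_def by (simp del: is_string.simps)
qed

text \<open>In \<open>z = yx\<close> the factor \<open>x\<close> is a suffix of the list and
  \<open>y\<close> the complementary prefix. The strict bounds keep both nonempty, as
  \<open>Word []\<close> is not a string.\<close>

lemma left_substring_drop:
  assumes "is_string Q \<rho> (Word xs)" "0 < n" "n < length xs"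
  shows "left_substring Q \<rho> \<sigma> \<epsilon> (Word (drop n xs)) (Word xs)"
  unfolding left_substring_def
proof (intro conjI exI)
  show "is_string Q \<rho> (Word (drop n xs))" "is_string Q \<rho> (Word (take n xs))"
    using assms by (auto intro!: is_string_sublist[OF assms(1)] simp del: is_string.simps)
qed (use assms in auto)

lemma hereditary_H_string_length_le:
  assumes N: "1 \<le> N" "\<And>r. r \<in> \<rho> \<Longrightarrow> length r \<le> N"
    and S: "finite S" "set xs \<subseteq> S"
    and xs: "hereditary_H_string Q \<rho> \<sigma> \<epsilon> (Word xs)"
  shows "length xs \<le> Suc (card {w. set w \<subseteq> S \<and> length w \<le> N})"
proof -
  have str: "is_string Q \<rho> (Word xs)"
    using xs hereditary_H_string_def by metis
  have drop_str: "is_string Q \<rho> (Word (drop i xs))" if "i < length xs" for i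
    using that by (intro is_string_sublist[OF str]) auto
  \<comment> \<open>For \<open>i < j\<close> the shorter word is a proper left substring of the
    longer one, which is an H-string by heredity. Starting at 1 leaves out the whole word, whence
    the \<open>Suc\<close> in the bound.\<close>
  have "take N (drop i xs) \<noteq> take N (drop j xs)" if ij: "1 \<le> i" "i < j" "j < length xs" for i j
  proof
    assume "take N (drop i xs) = take N (drop j xs)"
    then have "H_equivalent Q \<rho> \<sigma> \<epsilon> (Word (drop i xs)) (Word (drop j xs))"
      using drop_str ij by (intro H_equivalent_if_take_eq[OF N]) (auto simp del: is_string.simps)
    moreover have "left_substring Q \<rho> \<sigma> \<epsilon> (Word (drop j xs)) (Word (drop i xs))"
      using left_substring_drop[OF drop_str, of i "j - i"] ij by simp
    moreover have "H_string Q \<rho> \<sigma> \<epsilon> (Word (drop i xs))"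
      using xs left_substring_drop[OF str, of i] ij unfolding hereditary_H_string_def by auto
    moreover have "Word (drop j xs) \<noteq> Word (drop i xs)"
      using ij by (auto dest!: arg_cong[of "drop j xs" _ length])
    ultimately show False
      by (simp add: H_string_def)
  qed
  then have "inj_on (\<lambda>i. take N (drop i xs)) {1..<length xs}"
    by (intro linorder_inj_onI) auto
  \<comment> \<open>Windows near the end of the list may be shorter than \<open>N\<close>, so all
    lengths up to \<open>N\<close> are counted.\<close>
  moreover have "(\<lambda>i. take N (drop i xs)) ` {1..<length xs} \<subseteq> {w. set w \<subseteq> S \<and> length w \<le> N}"
    using S(2) by (auto dest!: in_set_takeD in_set_dropD)
  ultimately have "card {1..<length xs} \<le> card {w. set w \<subseteq> S \<and> length w \<le> N}"
    using card_inj_on_le finite_lists_length_le[OF S(1)] by blast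
  then show ?thesis
    by simp
qed

theorem corollary5p8:
  fixes K :: "'k ring" and Q :: "('v, 'a) pre_digraph" and \<rho> :: "'a list set"
    and \<Lambda> :: "('k, ('v \<times> 'a list \<Rightarrow> 'k) set) module"
    and \<sigma> \<epsilon> :: "'a \<Rightarrow> int"
  assumes "string_algebra K Q \<rho> \<Lambda>"
    and "sign_functions Q \<rho> \<sigma> \<epsilon>"
    and "domestic Q \<rho>"
  shows "finite {y. hereditary_H_string Q \<rho> \<sigma> \<epsilon> y}"
proof -
  interpret string_algebra K Q \<rho> \<Lambda>
    by fact
  obtain N where N: "1 \<le> N" "\<And>r. r \<in> \<rho> \<Longrightarrow> length r \<le> N"
    using relation_length_bounded by blast
  \<comment> \<open>\<open>S\<close> is the finite alphabet of all syllables over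
    \<open>Q\<close>.\<close>
  define S where "S = Direct ` arcs Q \<union> Inverse ` arcs Q"
  define M where "M = Suc (card {w. set w \<subseteq> S \<and> length w \<le> N})"
  have S: "finite S"
    by (simp add: S_def)
  have "y \<in> case_prod Trivial ` (verts Q \<times> {1, -1}) \<union> Word ` {xs. set xs \<subseteq> S \<and> length xs \<le> M}"
    if y: "hereditary_H_string Q \<rho> \<sigma> \<epsilon> y" for y
  proof (cases y)
    case (Trivial v i)
    then show ?thesis
      using y by (auto simp: hereditary_H_string_def)
  next
    case (Word xs)
    have "x \<in> S" if "x \<in> set xs" for x
    proof -
      have "arrow x \<in> arcs Q"
        using y that by (auto simp: Word hereditary_H_string_def)
      then show ?thesis
        by (cases x) (auto simp: S_def)
    qed
    then have "set xs \<subseteq> S"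
      by blast
    then show ?thesis
      using hereditary_H_string_length_le[OF N S] y unfolding Word M_def by blast
  qed
  then have "{y. hereditary_H_string Q \<rho> \<sigma> \<epsilon> y} \<subseteq>
      case_prod Trivial ` (verts Q \<times> {1, -1}) \<union> Word ` {xs. set xs \<subseteq> S \<and> length xs \<le> M}"
    by blast
  then show ?thesis
    by (rule finite_subset) (simp add: finite_lists_length_le[OF S])
qed

end
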